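(* Let $m,s\in\mathbb{N}$ and let $\mathbb{K}=\prod_{i=1}^m\mathbb{F}_{q_i}$ and $\mathbb{F}=\prod_{i=1}^s\mathbb{F}_{p_i}$ be products of finite fields such that $|\mathbb{K}|$ and $|\mathbb{F}|$ are coprime. Then every $(\mathbb{F},\mathbb{K})$-linearly closed clonoid is generated by a set of unary functions, and thus there are finitely many distinct $(\mathbb{F},\mathbb{K})$-linearly closed clonoids.
   Context: $\mathbb{N}$ is the set of positive integers, and for a prime power $q$, $\mathbb{F}_q$ is the field with $q$ elements; here all $q_i$ and $p_i$ are prime powers (with repetitions allowed). For $k\in\mathbb{N}$, a $k$-ary function from $\mathbb{K}=\prod_{j=1}^m\mathbb{F}_{q_j}$ to $\mathbb{F}=\prod_{i=1}^s\mathbb{F}_{p_i}$ is a function $f\colon\prod_{j=1}^m\mathbb{F}_{q_j}^k\to\mathbb{F}$; unary means $k=1$. For a set $C$ of such functions of various arities, $C^{[k]}$ denotes the set of its $k$-ary members. An $(\mathbb{F},\mathbb{K})$-linearly closed clonoid is a non-empty set $C$ of finitary functions from $\mathbb{K}$ to $\mathbb{F}$ (of arities $k\in\mathbb{N}$) such that: (1) for all $n\in\mathbb{N}$, $\mathbf{a},\mathbf{b}\in\mathbb{F}$ and $f,g\in C^{[n]}$, we have $\mathbf{a}f+\mathbf{b}g\in C^{[n]}$, where $\mathbf{a}f$ denotes the component-wise product in $\prod_{i=1}^s\mathbb{F}_{p_i}$; (2) for all $l,n\in\mathbb{N}$, $f\in C^{[n]}$ and matrices $A_j\in\mathbb{F}_{q_j}^{n\times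 l}$ ($1\le j\le m$), the function $(\mathbf{x}_1,\dots,\mathbf{x}_m)\mapsto f(A_1\mathbf{x}_1,\dots,A_m\mathbf{x}_m)$ from $\prod_{j=1}^m\mathbb{F}_{q_j}^l$ to $\mathbb{F}$ (vectors regarded as columns) is in $C^{[l]}$. A clonoid $C$ is generated by a set $S$ of functions if it is the smallest $(\mathbb{F},\mathbb{K})$-linearly closed clonoid containing $S$. *)

theory Defs
  imports "HOL-Algebra.Ring" "HOL-Algebra.Coset" "HOL-Library.FuncSet"
begin

text \<open>A family of \<open>m\<close> fields is given by \<open>K 0, \<dots>, K (m - 1)\<close>. Only these members matter; the
  carriers all live in one type, but the fields may have different sizes and operations.\<close>

definition prod_ring :: "nat \<Rightarrow> (nat \<Rightarrow> 'a ring) \<Rightarrow> (nat \<Rightarrow> 'a) ring" where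
  "prod_ring m K =
    \<lparr>carrier = (\<Pi>\<^sub>E j\<in>{..<m}. carrier (K j)),
     monoid.mult = (\<lambda>a b. \<lambda>j\<in>{..<m}. a j \<otimes>\<^bsub>K j\<^esub> b j),
     one = (\<lambda>j\<in>{..<m}. \<one>\<^bsub>K j\<^esub>),
     zero = (\<lambda>j\<in>{..<m}. \<zero>\<^bsub>K j\<^esub>),
     add = (\<lambda>a b. \<lambda>j\<in>{..<m}. a j \<oplus>\<^bsub>K j\<^esub> b j)\<rparr>"

text \<open>An element \<open>x\<close> of \<open>vec_prod m K k\<close> is a tuple of \<open>m\<close> vectors, the \<open>j\<close>-th of which is
  \<open>x j \<in> (K j)\<^sup>k\<close>.\<close>

definition vec_prod :: "nat \<Rightarrow> (nat \<Rightarrow> 'a ring) \<Rightarrow> nat \<Rightarrow> (nat \<Rightarrow> nat \<Rightarrow> 'a) set" where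
  "vec_prod m K k = (\<Pi>\<^sub>E j\<in>{..<m}. \<Pi>\<^sub>E i\<in>{..<k}. carrier (K j))"

type_synonym ('a, 'b) kfun = "(nat \<Rightarrow> nat \<Rightarrow> 'a) \<Rightarrow> (nat \<Rightarrow> 'b)"

definition kary_funs ::
  "nat \<Rightarrow> (nat \<Rightarrow> 'a ring) \<Rightarrow> nat \<Rightarrow> (nat \<Rightarrow> 'b ring) \<Rightarrow> nat \<Rightarrow> ('a, 'b) kfun set" where
  "kary_funs m K s F k = (vec_prod m K k \<rightarrow>\<^sub>E carrier (prod_ring s F))"

definition mat_vec :: "'a ring \<Rightarrow> nat \<Rightarrow> nat \<Rightarrow> (nat \<Rightarrow> nat \<Rightarrow> 'a) \<Rightarrow> (nat \<Rightarrow> 'a) \<Rightarrow> nat \<Rightarrow> 'a" where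
  "mat_vec R n l A x = (\<lambda>r\<in>{..<n}. \<Oplus>\<^bsub>R\<^esub>c\<in>{..<l}. A r c \<otimes>\<^bsub>R\<^esub> x c)"

text \<open>A set of finitary functions is a set of pairs \<open>(k, f)\<close> with \<open>f\<close> a \<open>k\<close>-ary function. The arity
  is recorded explicitly because an extensional function need not determine it: \<open>undefined\<close> may lie
  in the carriers. Arities are positive.\<close>

definition linearly_closed_clonoid ::
  "nat \<Rightarrow> (nat \<Rightarrow> 'a ring) \<Rightarrow> nat \<Rightarrow> (nat \<Rightarrow> 'b ring) \<Rightarrow> (nat \<times> ('a, 'b) kfun) set \<Rightarrow> bool" where
  "linearly_closed_clonoid m K s F C \<longleftrightarrow>
     C \<noteq> {} \<and>
     (\<forall>k f. (k, f) \<in> C \<longrightarrow> k \<ge> 1 \<and> f \<in> kary_funs m K s F k) \<and>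
     (\<forall>n\<ge>1. \<forall>a \<in> carrier (prod_ring s F). \<forall>b \<in> carrier (prod_ring s F). \<forall>f g.
        (n, f) \<in> C \<longrightarrow> (n, g) \<in> C \<longrightarrow>
        (n, \<lambda>x\<in>vec_prod m K n.
              a \<otimes>\<^bsub>prod_ring s F\<^esub> f x \<oplus>\<^bsub>prod_ring s F\<^esub> b \<otimes>\<^bsub>prod_ring s F\<^esub> g x) \<in> C) \<and>
     (\<forall>l\<ge>1. \<forall>n\<ge>1. \<forall>f A.
        (n, f) \<in> C \<longrightarrow>
        (\<forall>j<m. \<forall>r<n. \<forall>c<l. A j r c \<in> carrier (K j)) \<longrightarrow>
        (l, \<lambda>x\<in>vec_prod m K l. f (\<lambda>j\<in>{..<m}. mat_vec (K j) n l (A j) (x j))) \<in> C)"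

definition generated_by ::
  "nat \<Rightarrow> (nat \<Rightarrow> 'a ring) \<Rightarrow> nat \<Rightarrow> (nat \<Rightarrow> 'b ring) \<Rightarrow>
   (nat \<times> ('a, 'b) kfun) set \<Rightarrow> (nat \<times> ('a, 'b) kfun) set \<Rightarrow> bool" where
  "generated_by m K s F C S \<longleftrightarrow>
     linearly_closed_clonoid m K s F C \<and> S \<subseteq> C \<and>
     (\<forall>D. linearly_closed_clonoid m K s F D \<longrightarrow> S \<subseteq> D \<longrightarrow> C \<subseteq> D)"

end

theory Submission
  imports Defs "HOL-Algebra.Multiplicative_Group" "HOL-Number_Theory.Cong"
begin

text \<open>
  Let \<open>f\<close> be an \<open>n\<close>-ary member of a clonoid \<open>C\<close> and let \<open>E\<close> be a tuple of \<open>n \<times> n\<close> matrices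
  \<open>E\<^sub>j = u\<^sub>j v\<^sub>j\<^sup>T\<close>. Then \<open>x \<mapsto> f (E x)\<close> is a minor of the unary function \<open>y \<mapsto> f (u y)\<close>, which is
  itself a minor of \<open>f\<close>. So \<open>f\<close> lies in the clonoid generated by the unary members of \<open>C\<close> as soon as
  it is an integer combination of functions \<open>x \<mapsto> f (E x)\<close> with such \<open>E\<close>.

  The values of \<open>f\<close> lie in a finite additive group, of order \<open>N\<close> say. Therefore only the
  coefficients modulo \<open>N\<close> matter, and it is enough to have a formal identity between points:
  every \<open>x\<close> is, modulo \<open>N\<close>, a combination of the points \<open>E x\<close>, with coefficients and matrices that
  do not depend on \<open>x\<close>. The set \<open>int_span\<close> expresses this by testing against all integer-valued
  functions; \<open>rank_one_on_span\<close> is the identity for the whole product and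
  \<open>foldr_eq_if_cong\<close> transfers it to functions with values in the group.

  Everything reduces to a plane over one field with \<open>q\<close> elements (\<open>plane_identity\<close>): with
  \<open>l = s + a t\<close>,
  \<open>q (f (s, t) - f (0, 0)) = (\<Sum>\<^sub>a \<Sum>\<^sub>b f ((1 - a b) l, b l) - f (- a b l, b l)) + (\<Sum>\<^sub>y f (y t, t) - f (y t, 0))\<close>,
  where each argument on the right is the image of \<open>(s, t)\<close> under a matrix of rank at most one.
  Coprimality makes \<open>q\<close> invertible modulo \<open>N\<close>. A space of dimension \<open>n\<close> follows by merging one
  more coordinate at a time into the line already reached, and a product of spaces by treating one
  factor at a time.

  Hence inclusion between clonoids is decided by their unary members
  (\<open>clonoid_determined_by_unary\<close>). This gives the generation by unary functions, and also
  finiteness, since there are only finitely many sets of unary functions.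
\<close>

section \<open>Combinations of maps modulo an integer\<close>

text \<open>An operator \<open>\<Phi>\<close> belongs to the span if modulo \<open>N\<close> it is evaluation at a sum of points
  \<open>\<phi> x\<close> with \<open>\<phi> \<in> R\<close>, where the list of maps \<open>\<phi>\<close> does not depend on \<open>x\<close>. Since \<open>f\<close> is arbitrary,
  this is an identity in the free module over the integers modulo \<open>N\<close> on the points; in
  particular \<open>(\<lambda>x f. f (h x)) \<in> int_span N X R\<close> says that \<open>h\<close> is a combination of members of
  \<open>R\<close>. Repetitions in the list stand for the coefficients, so that \<open>-1\<close> becomes \<open>N - 1\<close> copies.\<close>

definition int_span :: "nat \<Rightarrow> 'x set \<Rightarrow> ('x \<Rightarrow> 'y) set \<Rightarrow> ('x \<Rightarrow> ('y \<Rightarrow> int) \<Rightarrow> int) set" where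
  "int_span N X R =
    {\<Phi>. \<exists>\<phi>s. set \<phi>s \<subseteq> R \<and> (\<forall>x\<in>X. \<forall>f. [\<Phi> x f = (\<Sum>\<phi>\<leftarrow>\<phi>s. f (\<phi> x))] (mod int N))}"

lemma int_spanI:
  assumes "set \<phi>s \<subseteq> R" "\<And>x f. x \<in> X \<Longrightarrow> [\<Phi> x f = (\<Sum>\<phi>\<leftarrow>\<phi>s. f (\<phi> x))] (mod int N)"
  shows "\<Phi> \<in> int_span N X R"
  using assms unfolding int_span_def by blast

lemma int_spanE:
  assumes "\<Phi> \<in> int_span N X R"
  obtains \<phi>s where "set \<phi>s \<subseteq> R"
    "\<And>x f. x \<in> X \<Longrightarrow> [\<Phi> x f = (\<Sum>\<phi>\<leftarrow>\<phi>s. f (\<phi> x))] (mod int N)"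
  using assms unfolding int_span_def by blast

lemma int_span_cong:
  assumes "\<Phi> \<in> int_span N X R" "\<And>x f. x \<in> X \<Longrightarrow> [\<Psi> x f = \<Phi> x f] (mod int N)"
  shows "\<Psi> \<in> int_span N X R"
  using assms(1)
proof (rule int_spanE)
  fix \<phi>s assume "set \<phi>s \<subseteq> R" "\<And>x f. x \<in> X \<Longrightarrow> [\<Phi> x f = (\<Sum>\<phi>\<leftarrow>\<phi>s. f (\<phi> x))] (mod int N)"
  then show ?thesis
    by (intro int_spanI[of \<phi>s]) (auto intro: cong_trans assms(2))
qed

lemma int_span_base: "\<phi> \<in> R \<Longrightarrow> (\<lambda>x f. f (\<phi> x)) \<in> int_span N X R"
  by (rule int_spanI[of "[\<phi>]"]) auto

lemma int_span_zero: "(\<lambda>x f. 0) \<in> int_span N X R"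
  by (rule int_spanI[of "[]"]) auto

lemma int_span_add:
  assumes "\<Phi> \<in> int_span N X R" "\<Psi> \<in> int_span N X R"
  shows "(\<lambda>x f. \<Phi> x f + \<Psi> x f) \<in> int_span N X R"
proof -
  obtain \<phi>s where 1: "set \<phi>s \<subseteq> R"
    "\<And>x f. x \<in> X \<Longrightarrow> [\<Phi> x f = (\<Sum>\<phi>\<leftarrow>\<phi>s. f (\<phi> x))] (mod int N)"
    using int_spanE[OF assms(1)] by blast
  obtain \<psi>s where 2: "set \<psi>s \<subseteq> R"
    "\<And>x f. x \<in> X \<Longrightarrow> [\<Psi> x f = (\<Sum>\<phi>\<leftarrow>\<psi>s. f (\<phi> x))] (mod int N)"
    using int_spanE[OF assms(2)] by blast
  show ?thesis
    by (rule int_spanI[of "\<phi>s @ \<psi>s"]) (use 1 2 in \<open>auto intro: cong_add\<close>)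
qed

lemma int_span_scale_nat:
  assumes "\<Phi> \<in> int_span N X R"
  shows "(\<lambda>x f. int k * \<Phi> x f) \<in> int_span N X R"
proof (induction k)
  case 0
  then show ?case by (simp add: int_span_zero)
next
  case (Suc k)
  from int_span_add[OF assms this] show ?case by (simp add: algebra_simps)
qed

lemma int_span_scale:
  assumes "\<Phi> \<in> int_span N X R" "N > 0"
  shows "(\<lambda>x f. z * \<Phi> x f) \<in> int_span N X R"
proof (rule int_span_cong[OF int_span_scale_nat[OF assms(1), of "nat (z mod int N)"]])
  fix x f
  show "[z * \<Phi> x f = int (nat (z mod int N)) * \<Phi> x f] (mod int N)"
    using assms(2) by (simp add: cong_def mod_mult_left_eq)
qed

lemma int_span_diff:
  assumes "\<Phi> \<in> int_span N X R" "\<Psi> \<in> int_span N X R" "N > 0"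
  shows "(\<lambda>x f. \<Phi> x f - \<Psi> x f) \<in> int_span N X R"
  using int_span_add[OF assms(1) int_span_scale[OF assms(2,3), of "-1"]] by simp

lemma int_span_sum:
  assumes "\<And>i. i \<in> I \<Longrightarrow> \<Phi> i \<in> int_span N X R"
  shows "(\<lambda>x f. \<Sum>i\<in>I. \<Phi> i x f) \<in> int_span N X R"
  using assms
proof (induction I rule: infinite_finite_induct)
  case (insert i I)
  then have "(\<lambda>x f. \<Phi> i x f + (\<Sum>i\<in>I. \<Phi> i x f)) \<in> int_span N X R"
    by (intro int_span_add) auto
  with insert show ?case by simp
qed (auto simp: int_span_zero)

lemma int_span_sum_list:
  assumes "\<And>\<phi>. \<phi> \<in> set \<phi>s \<Longrightarrow> \<Phi> \<phi> \<in> int_span N X R"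
  shows "(\<lambda>x f. \<Sum>\<phi>\<leftarrow>\<phi>s. \<Phi> \<phi> x f) \<in> int_span N X R"
  using assms by (induction \<phi>s) (auto intro: int_span_zero int_span_add)

lemma int_span_trans:
  assumes "\<Phi> \<in> int_span N X R" "\<And>\<phi>. \<phi> \<in> R \<Longrightarrow> (\<lambda>x f. f (\<phi> x)) \<in> int_span N X R'"
  shows "\<Phi> \<in> int_span N X R'"
proof -
  obtain \<phi>s where 1: "set \<phi>s \<subseteq> R"
    "\<And>x f. x \<in> X \<Longrightarrow> [\<Phi> x f = (\<Sum>\<phi>\<leftarrow>\<phi>s. f (\<phi> x))] (mod int N)"
    using int_spanE[OF assms(1)] by blast
  have "(\<lambda>x f. \<Sum>\<phi>\<leftarrow>\<phi>s. f (\<phi> x)) \<in> int_span N X R'"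
    by (rule int_span_sum_list[of \<phi>s "\<lambda>\<phi> x f. f (\<phi> x)"]) (use 1 assms(2) in auto)
  then show ?thesis by (rule int_span_cong) (use 1 in auto)
qed

text \<open>Spanning maps may be replaced inside any expression, even one that mentions \<open>x\<close> elsewhere: for
  a fixed \<open>x\<close>, the identity for \<open>h\<close> is tested against \<open>y \<mapsto> f (G x y)\<close>. This is what lets an
  identity for two coordinates, or for one factor, act while the other coordinates stay put.\<close>

lemma int_span_substitute:
  assumes "(\<lambda>y f. f (h y)) \<in> int_span N Y R"
    and g: "\<And>x. x \<in> X \<Longrightarrow> g x \<in> Y"
    and R': "\<And>r. r \<in> R \<Longrightarrow> \<exists>r'\<in>R'. \<forall>x\<in>X. G x (r (g x)) = r' x"
  shows "(\<lambda>x f. f (G x (h (g x)))) \<in> int_span N X R'"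
proof -
  obtain \<phi>s where 1: "set \<phi>s \<subseteq> R"
    "\<And>x f. x \<in> Y \<Longrightarrow> [f (h x) = (\<Sum>\<phi>\<leftarrow>\<phi>s. f (\<phi> x))] (mod int N)"
    using int_spanE[OF assms(1)] by metis
  obtain c where c: "\<And>r. r \<in> R \<Longrightarrow> c r \<in> R'" "\<And>r x. r \<in> R \<Longrightarrow> x \<in> X \<Longrightarrow> G x (r (g x)) = c r x"
    using R' by metis
  show ?thesis
  proof (rule int_spanI[of "map c \<phi>s"])
    show "set (map c \<phi>s) \<subseteq> R'" using 1 c by auto
    fix x and f :: "_ \<Rightarrow> int" assume x: "x \<in> X"
    have "(\<Sum>\<phi>\<leftarrow>\<phi>s. f (G x (\<phi> (g x)))) = (\<Sum>\<phi>\<leftarrow>map c \<phi>s. f (\<phi> x))"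
      using 1(1) c(2)[OF _ x] by (auto simp: comp_def intro!: arg_cong[where f = sum_list] map_cong)
    then show "[f (G x (h (g x))) = (\<Sum>\<phi>\<leftarrow>map c \<phi>s. f (\<phi> x))] (mod int N)"
      using 1(2)[OF g[OF x], of "\<lambda>y. f (G x y)"] by simp
  qed
qed

section \<open>Rank one in the plane\<close>

text \<open>An affine map of a finite field is either constant or a permutation.\<close>

lemma (in field) sum_affine:
  fixes g :: "'a \<Rightarrow> int"
  assumes "finite (carrier R)" "c \<in> carrier R" "d \<in> carrier R"
  shows "(\<Sum>y\<in>carrier R. g (d \<oplus> c \<otimes> y)) =
    (if c = \<zero> then int (card (carrier R)) * g d else (\<Sum>y\<in>carrier R. g y))"
proof (cases "c = \<zero>")
  case True
  then show ?thesis using assms by simp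
next
  case False
  then have c: "c \<in> Units R" using assms field_Units by blast
  have "inj_on (\<lambda>y. d \<oplus> c \<otimes> y) (carrier R)"
    using assms False by (auto intro!: inj_onI simp: m_lcancel)
  moreover have "(\<lambda>y. d \<oplus> c \<otimes> y) ` carrier R \<subseteq> carrier R" using assms by auto
  ultimately have "bij_betw (\<lambda>y. d \<oplus> c \<otimes> y) (carrier R) (carrier R)"
    using assms(1) by (simp add: bij_betw_def endo_inj_surj)
  from sum.reindex_bij_betw[OF this, of g] False show ?thesis by simp
qed

text \<open>Write \<open>T b\<close> for the sum of \<open>f\<close> over the line of points \<open>(y, b)\<close>. The substitution of
  \<open>b\<close> for \<open>b l\<close> turns the inner double sum into that of
  \<open>f (s + a (t - b), b) - f (- a b, b)\<close>; if \<open>l = 0\<close> this needs no substitution, as all differences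
  vanish before and after it. For fixed \<open>b\<close>, summation over \<open>a\<close> makes the first argument run
  through the field and contributes \<open>T b - T b = 0\<close>, with two exceptions: it is constantly \<open>s\<close> when
  \<open>b = t\<close>, and constantly \<open>0\<close> in the subtracted term when \<open>b = 0\<close>. The exceptions leave
  \<open>q f (s, t) - T t - q f (0, 0) + T 0\<close>, and the last sum of the identity is \<open>T t - T 0\<close>.\<close>

lemma (in field) plane_identity:
  fixes f :: "'a \<times> 'a \<Rightarrow> int"
  assumes fin: "finite (carrier R)" and s: "s \<in> carrier R" and t: "t \<in> carrier R"
  shows "int (card (carrier R)) * (f (s, t) - f (\<zero>, \<zero>)) =
    (\<Sum>a\<in>carrier R. \<Sum>b\<in>carrier R.
        f ((\<one> \<ominus> a \<otimes> b) \<otimes> (s \<oplus> a \<otimes> t), b \<otimes> (s \<oplus> a \<otimes> t))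
      - f ((\<ominus> (a \<otimes> b)) \<otimes> (s \<oplus> a \<otimes> t), b \<otimes> (s \<oplus> a \<otimes> t)))
    + (\<Sum>y\<in>carrier R. f (y \<otimes> t, t) - f (y \<otimes> t, \<zero>))"
proof -
  let ?K = "carrier R" and ?q = "int (card (carrier R))"
  define T where "T b = (\<Sum>y\<in>?K. f (y, b))" for b
  have inner: "(\<Sum>b\<in>?K. f ((\<one> \<ominus> a \<otimes> b) \<otimes> l, b \<otimes> l) - f ((\<ominus> (a \<otimes> b)) \<otimes> l, b \<otimes> l))
      = (\<Sum>b\<in>?K. f (l \<ominus> a \<otimes> b, b) - f (\<ominus> (a \<otimes> b), b))"
    if a: "a \<in> ?K" and l: "l \<in> ?K" for a l
  proof (cases "l = \<zero>")
    case True
    then show ?thesis using a by (auto intro!: sum.neutral simp: minus_eq)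
  next
    case False
    have "(\<Sum>b\<in>?K. f ((\<one> \<ominus> a \<otimes> b) \<otimes> l, b \<otimes> l) - f ((\<ominus> (a \<otimes> b)) \<otimes> l, b \<otimes> l))
      = (\<Sum>b\<in>?K. f (l \<ominus> a \<otimes> (\<zero> \<oplus> l \<otimes> b), \<zero> \<oplus> l \<otimes> b)
                - f (\<ominus> (a \<otimes> (\<zero> \<oplus> l \<otimes> b)), \<zero> \<oplus> l \<otimes> b))"
    proof (rule sum.cong[OF refl])
      fix b assume b: "b \<in> ?K"
      have "(\<one> \<ominus> a \<otimes> b) \<otimes> l = l \<ominus> a \<otimes> (\<zero> \<oplus> l \<otimes> b)"
        "(\<ominus> (a \<otimes> b)) \<otimes> l = \<ominus> (a \<otimes> (\<zero> \<oplus> l \<otimes> b))" "b \<otimes> l = \<zero> \<oplus> l \<otimes> b"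
        using a b l by (simp_all add: minus_eq l_distr l_minus m_assoc m_comm[of b l])
      then show "f ((\<one> \<ominus> a \<otimes> b) \<otimes> l, b \<otimes> l) - f ((\<ominus> (a \<otimes> b)) \<otimes> l, b \<otimes> l) =
        f (l \<ominus> a \<otimes> (\<zero> \<oplus> l \<otimes> b), \<zero> \<oplus> l \<otimes> b)
                - f (\<ominus> (a \<otimes> (\<zero> \<oplus> l \<otimes> b)), \<zero> \<oplus> l \<otimes> b)"
        by simp
    qed
    also have "\<dots> = (\<Sum>b\<in>?K. f (l \<ominus> a \<otimes> b, b) - f (\<ominus> (a \<otimes> b), b))"
      using sum_affine[OF fin l zero_closed, of "\<lambda>b. f (l \<ominus> a \<otimes> b, b) - f (\<ominus> (a \<otimes> b), b)"] False
      by simp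
    finally show ?thesis .
  qed
  have first: "(\<Sum>a\<in>?K. f ((s \<oplus> a \<otimes> t) \<ominus> a \<otimes> b, b)) = T b + (if b = t then ?q * f (s, t) - T t else 0)"
    if b: "b \<in> ?K" for b
  proof -
    have "(\<Sum>a\<in>?K. f ((s \<oplus> a \<otimes> t) \<ominus> a \<otimes> b, b)) = (\<Sum>a\<in>?K. f (s \<oplus> (t \<ominus> b) \<otimes> a, b))"
    proof (rule sum.cong[OF refl])
      fix a assume a: "a \<in> ?K"
      have "(s \<oplus> a \<otimes> t) \<ominus> a \<otimes> b = s \<oplus> (t \<ominus> b) \<otimes> a"
        using a b s t by (simp add: minus_eq l_distr l_minus a_assoc m_comm r_distr r_minus)
      then show "f ((s \<oplus> a \<otimes> t) \<ominus> a \<otimes> b, b) = f (s \<oplus> (t \<ominus> b) \<otimes> a, b)" by simp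
    qed
    moreover have "t \<ominus> b = \<zero> \<longleftrightarrow> b = t"
      using b t r_right_minus_eq by metis
    ultimately show ?thesis
      using sum_affine[OF fin minus_closed[OF t b] s, of "\<lambda>y. f (y, b)"] by (simp add: T_def)
  qed
  have second: "(\<Sum>a\<in>?K. f (\<ominus> (a \<otimes> b), b)) = T b + (if b = \<zero> then ?q * f (\<zero>, \<zero>) - T \<zero> else 0)"
    if b: "b \<in> ?K" for b
  proof -
    have "(\<Sum>a\<in>?K. f (\<ominus> (a \<otimes> b), b)) = (\<Sum>a\<in>?K. f (\<zero> \<oplus> (\<ominus> b) \<otimes> a, b))"
      by (rule sum.cong[OF refl]) (use b in \<open>simp add: l_minus r_minus m_comm\<close>)
    moreover have "\<ominus> b = \<zero> \<longleftrightarrow> b = \<zero>"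
      using b by (metis minus_minus minus_zero)
    ultimately show ?thesis
      using sum_affine[OF fin a_inv_closed[OF b] zero_closed, of "\<lambda>y. f (y, b)"]
      by (simp add: T_def)
  qed
  have third: "(\<Sum>y\<in>?K. f (y \<otimes> t, t) - f (y \<otimes> t, \<zero>)) = T t - T \<zero>"
  proof (cases "t = \<zero>")
    case True
    then show ?thesis by simp
  next
    case False
    have "(\<Sum>y\<in>?K. f (y \<otimes> t, t) - f (y \<otimes> t, \<zero>)) =
        (\<Sum>y\<in>?K. f (\<zero> \<oplus> t \<otimes> y, t) - f (\<zero> \<oplus> t \<otimes> y, \<zero>))"
      by (rule sum.cong[OF refl]) (use t in \<open>simp add: m_comm\<close>)
    then show ?thesis
      using sum_affine[OF fin t zero_closed, of "\<lambda>y. f (y, t) - f (y, \<zero>)"] False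
      by (simp add: T_def sum_subtractf)
  qed
  have "(\<Sum>a\<in>?K. \<Sum>b\<in>?K.
        f ((\<one> \<ominus> a \<otimes> b) \<otimes> (s \<oplus> a \<otimes> t), b \<otimes> (s \<oplus> a \<otimes> t))
      - f ((\<ominus> (a \<otimes> b)) \<otimes> (s \<oplus> a \<otimes> t), b \<otimes> (s \<oplus> a \<otimes> t)))
    = (\<Sum>a\<in>?K. \<Sum>b\<in>?K. f ((s \<oplus> a \<otimes> t) \<ominus> a \<otimes> b, b) - f (\<ominus> (a \<otimes> b), b))"
    using s t by (intro sum.cong[OF refl] inner) auto
  also have "\<dots> = (\<Sum>b\<in>?K. (\<Sum>a\<in>?K. f ((s \<oplus> a \<otimes> t) \<ominus> a \<otimes> b, b))
      - (\<Sum>a\<in>?K. f (\<ominus> (a \<otimes> b), b)))"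
    by (subst sum.swap) (simp add: sum_subtractf)
  also have "\<dots> = (\<Sum>b\<in>?K. (if b = t then ?q * f (s, t) - T t else 0)
      - (if b = \<zero> then ?q * f (\<zero>, \<zero>) - T \<zero> else 0))"
    by (rule sum.cong[OF refl]) (simp add: first second)
  also have "\<dots> = (?q * f (s, t) - T t) - (?q * f (\<zero>, \<zero>) - T \<zero>)"
    using fin t by (simp add: sum_subtractf)
  finally show ?thesis using third by (simp add: algebra_simps)
qed

definition plane_rank_one :: "'a ring \<Rightarrow> ('a \<times> 'a \<Rightarrow> 'a \<times> 'a) set" where
  "plane_rank_one R =
    {\<lambda>(s, t). (c \<otimes>\<^bsub>R\<^esub> (\<alpha> \<otimes>\<^bsub>R\<^esub> s \<oplus>\<^bsub>R\<^esub> \<beta> \<otimes>\<^bsub>R\<^esub> t),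
             d \<otimes>\<^bsub>R\<^esub> (\<alpha> \<otimes>\<^bsub>R\<^esub> s \<oplus>\<^bsub>R\<^esub> \<beta> \<otimes>\<^bsub>R\<^esub> t)) | c d \<alpha> \<beta>.
     c \<in> carrier R \<and> d \<in> carrier R \<and> \<alpha> \<in> carrier R \<and> \<beta> \<in> carrier R}"

text \<open>The cardinality of the field is invertible modulo \<open>N\<close>, so the plane identity can be solved for
  \<open>f (s, t)\<close>; the point \<open>(0, 0)\<close> is the image under the zero matrix.\<close>

lemma plane_rank_one_span:
  fixes R (structure)
  assumes "field R" and fin: "finite (carrier R)" and cop: "coprime (card (carrier R)) N" and "N > 0"
  shows "(\<lambda>p f. f p) \<in> int_span N (carrier R \<times> carrier R) (plane_rank_one R)"
proof -
  interpret field R by fact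
  let ?K = "carrier R" and ?X = "carrier R \<times> carrier R"
  have ev: "(\<lambda>x f. f (case x of (s, t) \<Rightarrow> (c \<otimes> (\<alpha> \<otimes> s \<oplus> \<beta> \<otimes> t), d \<otimes> (\<alpha> \<otimes> s \<oplus> \<beta> \<otimes> t))))
      \<in> int_span N ?X (plane_rank_one R)"
    if "c \<in> ?K" "d \<in> ?K" "\<alpha> \<in> ?K" "\<beta> \<in> ?K" for c d \<alpha> \<beta>
    using that by (intro int_span_base) (auto simp: plane_rank_one_def)
  \<comment> \<open>The four shapes of points in the plane identity, as instances of the general rank-one map.\<close>
  have ev1: "(\<lambda>x f. f (case x of (s, t) \<Rightarrow> (c \<otimes> (s \<oplus> a \<otimes> t), d \<otimes> (s \<oplus> a \<otimes> t))))
      \<in> int_span N ?X (plane_rank_one R)"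
    if "c \<in> ?K" "d \<in> ?K" "a \<in> ?K" for c d a
    by (rule int_span_cong[OF ev[OF that(1,2) one_closed that(3)]]) (use that in auto)
  have ev2: "(\<lambda>x f. f (case x of (s, t) \<Rightarrow> (y \<otimes> t, t))) \<in> int_span N ?X (plane_rank_one R)"
    if "y \<in> ?K" for y
    by (rule int_span_cong[OF ev[OF that one_closed zero_closed one_closed]]) (use that in auto)
  have ev3: "(\<lambda>x f. f (case x of (s, t) \<Rightarrow> (y \<otimes> t, \<zero>))) \<in> int_span N ?X (plane_rank_one R)"
    if "y \<in> ?K" for y
    by (rule int_span_cong[OF ev[OF that zero_closed zero_closed one_closed]]) (use that in auto)
  have ev4: "(\<lambda>x f. f (\<zero>, \<zero>)) \<in> int_span N ?X (plane_rank_one R)"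
    by (rule int_span_cong[OF ev[OF zero_closed zero_closed zero_closed zero_closed]]) auto
  define \<Phi> where "\<Phi> x f = 
    (\<Sum>a\<in>?K. \<Sum>b\<in>?K.
        f (case x of (s, t) \<Rightarrow> ((\<one> \<ominus> a \<otimes> b) \<otimes> (s \<oplus> a \<otimes> t), b \<otimes> (s \<oplus> a \<otimes> t)))
      - f (case x of (s, t) \<Rightarrow> ((\<ominus> (a \<otimes> b)) \<otimes> (s \<oplus> a \<otimes> t), b \<otimes> (s \<oplus> a \<otimes> t))))
    + (\<Sum>y\<in>?K. f (case x of (s, t) \<Rightarrow> (y \<otimes> t, t)) - f (case x of (s, t) \<Rightarrow> (y \<otimes> t, \<zero>)))"
    for x and f :: "'a \<times> 'a \<Rightarrow> int"
  have \<Phi>: "\<Phi> \<in> int_span N ?X (plane_rank_one R)"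
    unfolding \<Phi>_def
    by (intro int_span_add int_span_sum int_span_diff ev1 ev2 ev3 \<open>N > 0\<close>) auto
  have "coprime (int (card ?K)) (int N)" using cop by simp
  then obtain w where w: "[int (card ?K) * w = 1] (mod int N)"
    using cong_solve_coprime_int by blast
  show ?thesis
  proof (rule int_span_cong[OF int_span_add[OF ev4 int_span_scale[OF \<Phi> \<open>N > 0\<close>, of w]]])
    fix x and f :: "'a \<times> 'a \<Rightarrow> int" assume "x \<in> ?X"
    then obtain s t where x: "x = (s, t)" "s \<in> ?K" "t \<in> ?K" by auto
    have "\<Phi> x f = int (card ?K) * (f x - f (\<zero>, \<zero>))"
      unfolding \<Phi>_def x(1) using plane_identity[OF fin x(2,3), of f] by simp
    then have "w * \<Phi> x f = int (card ?K) * w * (f x - f (\<zero>, \<zero>))"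
      by simp
    also have "[\<dots> = 1 * (f x - f (\<zero>, \<zero>))] (mod int N)"
      using w by (rule cong_scalar_right)
    finally have "[f (\<zero>, \<zero>) + w * \<Phi> x f = f (\<zero>, \<zero>) + 1 * (f x - f (\<zero>, \<zero>))] (mod int N)"
      by (intro cong_add) auto
    then show "[f x = f (\<zero>, \<zero>) + w * \<Phi> x f] (mod int N)"
      by (simp add: cong_sym)
  qed
qed

section \<open>Rank one in a vector space\<close>

text \<open>An endomorphism with matrix \<open>u v\<^sup>T\<close> on the first \<open>k\<close> coordinates and the identity on the others:
  the intermediate stage of the induction over the coordinates.\<close>

definition partial_rank_one ::
  "'a ring \<Rightarrow> nat \<Rightarrow> nat \<Rightarrow> (nat \<Rightarrow> 'a) \<Rightarrow> (nat \<Rightarrow> 'a) \<Rightarrow> (nat \<Rightarrow> 'a) \<Rightarrow> nat \<Rightarrow> 'a" where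
  "partial_rank_one R n k u v x =
    (\<lambda>i\<in>{..<n}. if i < k then u i \<otimes>\<^bsub>R\<^esub> (\<Oplus>\<^bsub>R\<^esub>c\<in>{..<k}. v c \<otimes>\<^bsub>R\<^esub> x c) else x i)"

text \<open>When the first \<open>k\<close> coordinates are already \<open>u\<^sub>i l\<close> for a linear form \<open>l\<close>, the vector depends on
  them only through \<open>l\<close>. The plane result for the pair of \<open>l\<close> and the next coordinate then replaces
  both by multiples of a single linear form in \<open>k + 1\<close> coordinates.\<close>

lemma partial_rank_one_span:
  fixes R (structure)
  assumes "field R" and fin: "finite (carrier R)" and cop: "coprime (card (carrier R)) N" and "N > 0"
    and "k \<le> n"
  shows "(\<lambda>x f. f x) \<in> int_span N ({..<n} \<rightarrow>\<^sub>E carrier R)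
    {partial_rank_one R n k u v | u v. u \<in> UNIV \<rightarrow> carrier R \<and> v \<in> UNIV \<rightarrow> carrier R}"
    (is "_ \<in> int_span N ?X (?R k)")
  using \<open>k \<le> n\<close>
proof (induction k)
  interpret field R by fact
  case 0
  have "(\<lambda>x f. f (partial_rank_one R n 0 (\<lambda>_. \<zero>) (\<lambda>_. \<zero>) x)) \<in> int_span N ?X (?R 0)"
    by (intro int_span_base) blast
  then show ?case
    by (rule int_span_cong) (simp add: partial_rank_one_def PiE_restrict cong: restrict_cong)
next
  interpret field R by fact
  case (Suc k)
  then have "(\<lambda>x f. f x) \<in> int_span N ?X (?R k)" by simp
  then show ?case
  proof (rule int_span_trans)
    fix \<phi> assume "\<phi> \<in> ?R k"
    then obtain u v where \<phi>: "\<phi> = partial_rank_one R n k u v"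
      and "u \<in> UNIV \<rightarrow> carrier R" "v \<in> UNIV \<rightarrow> carrier R"
      by blast
    then have u: "\<And>i. u i \<in> carrier R" and v: "\<And>i. v i \<in> carrier R" by auto
    define l where "l x = (\<Oplus>c\<in>{..<k}. v c \<otimes> x c)" for x
    define G where "G x p = (\<lambda>i\<in>{..<n}. if i < k then u i \<otimes> fst p else if i = k then snd p else x i)"
      for x and p :: "'a \<times> 'a"
    have x: "x i \<in> carrier R" if "x \<in> ?X" "i \<le> k" for x i
      using that Suc.prems by (auto simp: PiE_iff)
    have l: "l x \<in> carrier R" if "x \<in> ?X" for x
      unfolding l_def using v x[OF that] by (intro finsum_closed) auto
    have "(\<lambda>x f. f (G x (l x, x k))) \<in> int_span N ?X (?R (Suc k))"
    proof (rule int_span_substitute[where h = "\<lambda>p. p" and g = "\<lambda>x. (l x, x k)",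
          OF plane_rank_one_span[OF \<open>field R\<close> fin cop \<open>N > 0\<close>]])
      show "(l x, x k) \<in> carrier R \<times> carrier R" if "x \<in> ?X" for x
        using l x that by auto
      fix r assume "r \<in> plane_rank_one R"
      then obtain c d \<alpha> \<beta> where
        r: "r = (\<lambda>(s, t). (c \<otimes> (\<alpha> \<otimes> s \<oplus> \<beta> \<otimes> t), d \<otimes> (\<alpha> \<otimes> s \<oplus> \<beta> \<otimes> t)))"
        and K: "c \<in> carrier R" "d \<in> carrier R" "\<alpha> \<in> carrier R" "\<beta> \<in> carrier R"
        unfolding plane_rank_one_def by auto
      define u' where "u' i = (if i = k then d else u i \<otimes> c)" for i
      define v' where "v' i = (if i = k then \<beta> else \<alpha> \<otimes> v i)" for i
      have uv': "u' \<in> UNIV \<rightarrow> carrier R" "v' \<in> UNIV \<rightarrow> carrier R"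
        using u v K by (auto simp: u'_def v'_def)
      have "G x (r (l x, x k)) = partial_rank_one R n (Suc k) u' v' x" if X: "x \<in> ?X" for x
      proof -
        have "(\<Oplus>i\<in>{..<Suc k}. v' i \<otimes> x i) = v' k \<otimes> x k \<oplus> (\<Oplus>i\<in>{..<k}. v' i \<otimes> x i)"
          unfolding lessThan_Suc using uv' x[OF X] by (intro finsum_insert) (auto simp: Pi_iff)
        also have "(\<Oplus>i\<in>{..<k}. v' i \<otimes> x i) = (\<Oplus>i\<in>{..<k}. \<alpha> \<otimes> (v i \<otimes> x i))"
          using u v K x[OF X] by (intro finsum_cong') (auto simp: v'_def m_assoc)
        also have "\<dots> = \<alpha> \<otimes> l x"
          unfolding l_def using v K x[OF X] by (intro finsum_rdistr[symmetric]) auto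
        finally have "(\<Oplus>i\<in>{..<Suc k}. v' i \<otimes> x i) = \<alpha> \<otimes> l x \<oplus> \<beta> \<otimes> x k"
          using K l[OF X] x[OF X, of k] by (simp add: v'_def a_comm)
        then show ?thesis
          using K l[OF X] x[OF X, of k] u
          by (auto simp: partial_rank_one_def G_def r u'_def m_assoc less_Suc_eq intro!: restrict_ext)
      qed
      then show "\<exists>r'\<in>?R (Suc k). \<forall>x\<in>?X. G x (r (l x, x k)) = r' x"
        using uv' by blast
    qed
    moreover have "G x (l x, x k) = \<phi> x" for x
      unfolding G_def \<phi> partial_rank_one_def l_def by (auto intro!: restrict_ext)
    ultimately show "(\<lambda>x f. f (\<phi> x)) \<in> int_span N ?X (?R (Suc k))" by simp
  qed
qed

text \<open>The matrix \<open>u v\<^sup>T\<close> is kept as a product of a column and a row, since the factorization through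
  dimension one is what produces unary functions.\<close>

definition through_line ::
  "'a ring \<Rightarrow> nat \<Rightarrow> (nat \<Rightarrow> 'a) \<Rightarrow> (nat \<Rightarrow> 'a) \<Rightarrow> (nat \<Rightarrow> 'a) \<Rightarrow> nat \<Rightarrow> 'a" where
  "through_line R n u v x = mat_vec R n 1 (\<lambda>r c. u r) (mat_vec R 1 n (\<lambda>r c. v c) x)"

lemma through_line_span:
  fixes R (structure)
  assumes "field R" and fin: "finite (carrier R)" and cop: "coprime (card (carrier R)) N" and "N > 0"
  shows "(\<lambda>x f. f x) \<in> int_span N ({..<n} \<rightarrow>\<^sub>E carrier R)
    {through_line R n u v | u v. u \<in> UNIV \<rightarrow> carrier R \<and> v \<in> UNIV \<rightarrow> carrier R}"
    (is "_ \<in> int_span N ?X ?R")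
proof (rule int_span_trans[OF partial_rank_one_span[OF assms order_refl[of n]]])
  interpret field R by fact
  fix \<phi> assume "\<phi> \<in> {partial_rank_one R n n u v | u v. u \<in> UNIV \<rightarrow> carrier R \<and> v \<in> UNIV \<rightarrow> carrier R}"
  then obtain u v where \<phi>: "\<phi> = partial_rank_one R n n u v"
    and u: "u \<in> UNIV \<rightarrow> carrier R" and v: "v \<in> UNIV \<rightarrow> carrier R"
    by auto
  have "(\<lambda>x f. f (through_line R n u v x)) \<in> int_span N ?X ?R"
    using u v by (intro int_span_base) blast
  then show "(\<lambda>x f. f (\<phi> x)) \<in> int_span N ?X ?R"
  proof (rule int_span_cong)
    fix x and f :: "(nat \<Rightarrow> 'a) \<Rightarrow> int" assume x: "x \<in> ?X"
    have s: "(\<Oplus>c\<in>{..<n}. v c \<otimes> x c) \<in> carrier R"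
      using v x by (intro finsum_closed) (auto simp: PiE_iff Pi_iff)
    have "through_line R n u v x = \<phi> x"
      unfolding through_line_def \<phi> partial_rank_one_def mat_vec_def
      using s u by (intro restrict_ext) (auto simp: lessThan_Suc finsum_insert Pi_iff)
    then show "[f (\<phi> x) = f (through_line R n u v x)] (mod int N)" by simp
  qed
qed

section \<open>Rank one in a product of vector spaces\<close>

definition rank_one_on ::
  "nat \<Rightarrow> (nat \<Rightarrow> 'a ring) \<Rightarrow> nat \<Rightarrow> nat \<Rightarrow> (nat \<Rightarrow> nat \<Rightarrow> 'a) \<Rightarrow> (nat \<Rightarrow> nat \<Rightarrow> 'a) \<Rightarrow>
   (nat \<Rightarrow> nat \<Rightarrow> 'a) \<Rightarrow> nat \<Rightarrow> nat \<Rightarrow> 'a" where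
  "rank_one_on m K n j U V x =
    (\<lambda>i\<in>{..<m}. if i < j then through_line (K i) n (U i) (V i) (x i) else x i)"

lemma rank_one_on_span:
  fixes K :: "nat \<Rightarrow> 'a ring"
  assumes K: "\<And>j. j < m \<Longrightarrow> field (K j) \<and> finite (carrier (K j)) \<and> coprime (card (carrier (K j))) N"
    and "N > 0" and "j \<le> m"
  shows "(\<lambda>x f. f x) \<in> int_span N (vec_prod m K n)
    {rank_one_on m K n j U V | U V. \<forall>i<j. U i \<in> UNIV \<rightarrow> carrier (K i) \<and> V i \<in> UNIV \<rightarrow> carrier (K i)}"
    (is "_ \<in> int_span N ?X (?R j)")
  using \<open>j \<le> m\<close>
proof (induction j)
  case 0
  have "(\<lambda>x f. f (rank_one_on m K n 0 U V x)) \<in> int_span N ?X (?R 0)" for U V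
    by (intro int_span_base) blast
  then show ?case
    by (rule int_span_cong) (simp add: rank_one_on_def vec_prod_def PiE_restrict cong: restrict_cong)
next
  case (Suc j)
  then have "(\<lambda>x f. f x) \<in> int_span N ?X (?R j)" by simp
  then show ?case
  proof (rule int_span_trans)
    fix \<phi> assume "\<phi> \<in> ?R j"
    then obtain U V where \<phi>: "\<phi> = rank_one_on m K n j U V"
      and UV: "\<And>i. i < j \<Longrightarrow> U i \<in> UNIV \<rightarrow> carrier (K i) \<and> V i \<in> UNIV \<rightarrow> carrier (K i)"
      by blast
    define G where "G x p = (\<lambda>i\<in>{..<m}. if i < j then through_line (K i) n (U i) (V i) (x i)
        else if i = j then p else x i)" for x :: "nat \<Rightarrow> nat \<Rightarrow> 'a" and p
    have "j < m" using Suc.prems by simp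
    have "(\<lambda>x f. f (G x (x j))) \<in> int_span N ?X (?R (Suc j))"
    proof (rule int_span_substitute[where h = "\<lambda>p. p" and g = "\<lambda>x. x j"])
      show "(\<lambda>x f. f x) \<in> int_span N ({..<n} \<rightarrow>\<^sub>E carrier (K j))
        {through_line (K j) n u v | u v. u \<in> UNIV \<rightarrow> carrier (K j) \<and> v \<in> UNIV \<rightarrow> carrier (K j)}"
        using K[OF \<open>j < m\<close>] \<open>N > 0\<close> by (intro through_line_span) auto
      show "x j \<in> {..<n} \<rightarrow>\<^sub>E carrier (K j)" if "x \<in> ?X" for x
        using that \<open>j < m\<close> by (auto simp: vec_prod_def PiE_iff)
      fix r assume "r \<in> {through_line (K j) n u v | u v. u \<in> UNIV \<rightarrow> carrier (K j) \<and> v \<in> UNIV \<rightarrow> carrier (K j)}"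
      then obtain u v where r: "r = through_line (K j) n u v"
        and uv: "u \<in> UNIV \<rightarrow> carrier (K j)" "v \<in> UNIV \<rightarrow> carrier (K j)"
        by blast
      have "\<forall>x\<in>?X. G x (r (x j)) = rank_one_on m K n (Suc j) (U(j := u)) (V(j := v)) x"
        unfolding G_def r rank_one_on_def by (auto simp: less_Suc_eq intro!: restrict_ext)
      moreover have "\<forall>i<Suc j. (U(j := u)) i \<in> UNIV \<rightarrow> carrier (K i) \<and> (V(j := v)) i \<in> UNIV \<rightarrow> carrier (K i)"
        using UV uv by (auto simp: less_Suc_eq)
      ultimately show "\<exists>r'\<in>?R (Suc j). \<forall>x\<in>?X. G x (r (x j)) = r' x" by blast
    qed
    moreover have "G x (x j) = \<phi> x" for x
      unfolding G_def \<phi> rank_one_on_def by (auto intro!: restrict_ext)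
    ultimately show "(\<lambda>x f. f (\<phi> x)) \<in> int_span N ?X (?R (Suc j))" by simp
  qed
qed

section \<open>Transfer to finite commutative groups\<close>

lemma (in group) pow_cong_mod_order:
  fixes i j :: nat
  assumes "a \<in> carrier G" "finite (carrier G)" "[i = j] (mod order G)"
  shows "a [^] i = a [^] j"
proof -
  have "a [^] k = a [^] (k mod order G)" for k :: nat
  proof -
    have "a [^] k = a [^] (order G * (k div order G)) \<otimes> a [^] (k mod order G)"
      using assms(1) by (simp add: nat_pow_mult)
    also have "a [^] (order G * (k div order G)) = \<one>"
      using assms(1,2) by (simp add: nat_pow_pow[symmetric] pow_order_eq_1)
    finally show ?thesis using assms(1) by simp
  qed
  then show ?thesis using assms(3) by (metis cong_def)
qed

text \<open>Testing the hypothesis on the indicator function of a point \<open>z\<close> shows that \<open>z\<close> occurs in \<open>ps\<close>,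
  modulo the order of the group, once if \<open>z = y\<close> and not at all otherwise; multiplicities modulo the
  order determine the product.\<close>

lemma (in comm_group) foldr_eq_if_cong:
  assumes fin: "finite (carrier G)"
    and f: "f \<in> insert y (set ps) \<rightarrow> carrier G"
    and cong: "\<And>g :: 'c \<Rightarrow> int. [g y = (\<Sum>p\<leftarrow>ps. g p)] (mod int (order G))"
  shows "foldr (\<lambda>p a. f p \<otimes> a) ps \<one> = f y"
proof -
  let ?Y = "insert y (set ps)"
  have count: "foldr (\<lambda>p a. f p \<otimes> a) qs \<one> = (\<Otimes>z\<in>?Y. f z [^] count_list qs z)"
    if "set qs \<subseteq> set ps" for qs
    using that
  proof (induction qs)
    case Nil
    then show ?case by (simp add: finprod_one_eqI)
  next
    case (Cons q qs)
    have "(\<Otimes>z\<in>?Y. f z [^] count_list (q # qs) z)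
        = (\<Otimes>z\<in>?Y. (if q = z then f z else \<one>) \<otimes> f z [^] count_list qs z)"
      using f by (intro finprod_cong') (auto simp: Pi_iff m_comm)
    also have "\<dots> = (\<Otimes>z\<in>?Y. if q = z then f z else \<one>) \<otimes> (\<Otimes>z\<in>?Y. f z [^] count_list qs z)"
      using f by (intro finprod_multf) (auto simp: Pi_iff)
    also have "(\<Otimes>z\<in>?Y. if q = z then f z else \<one>) = f q"
      using f Cons.prems by (intro finprod_singleton) auto
    finally show ?case using Cons by simp
  qed
  have "foldr (\<lambda>p a. f p \<otimes> a) ps \<one> = (\<Otimes>z\<in>?Y. f z [^] count_list ps z)"
    by (rule count) simp
  also have "\<dots> = (\<Otimes>z\<in>?Y. if y = z then f z else \<one>)"
  proof (rule finprod_cong')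
    fix z assume z: "z \<in> ?Y"
    have "(\<Sum>p\<leftarrow>qs. if p = z then 1 else 0 :: int) = int (count_list qs z)" for qs
      by (induction qs) auto
    then have "[int (count_list ps z) = (if y = z then 1 else 0)] (mod int (order G))"
      using cong[of "\<lambda>p. if p = z then 1 else 0"] by (simp add: cong_sym)
    then have "[count_list ps z = (if y = z then 1 else 0)] (mod order G)"
      by (metis cong_int_iff of_nat_0 of_nat_1)
    then have "f z [^] count_list ps z = f z [^] (if y = z then 1 else 0 :: nat)"
      using f z fin by (intro pow_cong_mod_order) auto
    then show "f z [^] count_list ps z = (if y = z then f z else \<one>)"
      using f z by auto
  qed (use f in auto)
  also have "\<dots> = f y"
    using f by (intro finprod_singleton) auto
  finally show ?thesis .
qed

section \<open>Clonoids and their unary members\<close>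

lemma abelian_group_prod_ring:
  assumes F: "\<And>i. i < s \<Longrightarrow> abelian_group (F i)"
  shows "abelian_group (prod_ring s F)"
proof (rule abelian_groupI)
  show "\<exists>y\<in>carrier (prod_ring s F). y \<oplus>\<^bsub>prod_ring s F\<^esub> x = \<zero>\<^bsub>prod_ring s F\<^esub>"
    if "x \<in> carrier (prod_ring s F)" for x
  proof (rule bexI[of _ "\<lambda>i\<in>{..<s}. \<ominus>\<^bsub>F i\<^esub> x i"])
    show "(\<lambda>i\<in>{..<s}. \<ominus>\<^bsub>F i\<^esub> x i) \<oplus>\<^bsub>prod_ring s F\<^esub> x = \<zero>\<^bsub>prod_ring s F\<^esub>"
      using that abelian_group.l_neg[OF F]
      by (auto simp: prod_ring_def PiE_iff intro!: restrict_ext)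
    show "(\<lambda>i\<in>{..<s}. \<ominus>\<^bsub>F i\<^esub> x i) \<in> carrier (prod_ring s F)"
      using that abelian_group.a_inv_closed[OF F] by (auto simp: prod_ring_def PiE_iff)
  qed
  show "x \<oplus>\<^bsub>prod_ring s F\<^esub> y \<in> carrier (prod_ring s F)"
    if "x \<in> carrier (prod_ring s F)" "y \<in> carrier (prod_ring s F)" for x y
    using that abelian_groupE(1)[OF F] by (auto simp: prod_ring_def PiE_iff)
  show "\<zero>\<^bsub>prod_ring s F\<^esub> \<in> carrier (prod_ring s F)"
    using abelian_groupE(2)[OF F] by (auto simp: prod_ring_def)
  show "x \<oplus>\<^bsub>prod_ring s F\<^esub> y \<oplus>\<^bsub>prod_ring s F\<^esub> z = x \<oplus>\<^bsub>prod_ring s F\<^esub> (y \<oplus>\<^bsub>prod_ring s F\<^esub> z)"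
    if "x \<in> carrier (prod_ring s F)" "y \<in> carrier (prod_ring s F)" "z \<in> carrier (prod_ring s F)" for x y z
    using that abelian_groupE(3)[OF F] by (auto simp: prod_ring_def PiE_iff intro!: restrict_ext)
  show "x \<oplus>\<^bsub>prod_ring s F\<^esub> y = y \<oplus>\<^bsub>prod_ring s F\<^esub> x"
    if "x \<in> carrier (prod_ring s F)" "y \<in> carrier (prod_ring s F)" for x y
    using that abelian_groupE(4)[OF F] by (auto simp: prod_ring_def PiE_iff intro!: restrict_ext)
  show "\<zero>\<^bsub>prod_ring s F\<^esub> \<oplus>\<^bsub>prod_ring s F\<^esub> x = x"
    if "x \<in> carrier (prod_ring s F)" for x
    using that abelian_groupE(5)[OF F]
    by (auto simp: prod_ring_def PiE_iff extensional_def fun_eq_iff)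
qed

lemma prod_ring_scalars:
  assumes R: "\<And>i. i < s \<Longrightarrow> ring (F i)"
  shows "\<one>\<^bsub>prod_ring s F\<^esub> \<in> carrier (prod_ring s F)"
    and "x \<in> carrier (prod_ring s F) \<Longrightarrow> \<one>\<^bsub>prod_ring s F\<^esub> \<otimes>\<^bsub>prod_ring s F\<^esub> x = x"
    and "x \<in> carrier (prod_ring s F) \<Longrightarrow>
      \<zero>\<^bsub>prod_ring s F\<^esub> \<otimes>\<^bsub>prod_ring s F\<^esub> x = \<zero>\<^bsub>prod_ring s F\<^esub>"
proof -
  have null: "\<zero>\<^bsub>F i\<^esub> \<otimes>\<^bsub>F i\<^esub> y = \<zero>\<^bsub>F i\<^esub>" if "i < s" "y \<in> carrier (F i)" for i y
  proof -
    interpret ring "F i" by (rule R[OF that(1)])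
    show ?thesis using that by simp
  qed
  show "\<one>\<^bsub>prod_ring s F\<^esub> \<in> carrier (prod_ring s F)"
    using monoid.one_closed[OF ring.is_monoid[OF R]] by (auto simp: prod_ring_def)
  show "\<one>\<^bsub>prod_ring s F\<^esub> \<otimes>\<^bsub>prod_ring s F\<^esub> x = x" if "x \<in> carrier (prod_ring s F)"
    using that monoid.l_one[OF ring.is_monoid[OF R]]
    by (auto simp: prod_ring_def PiE_iff extensional_def fun_eq_iff)
  show "\<zero>\<^bsub>prod_ring s F\<^esub> \<otimes>\<^bsub>prod_ring s F\<^esub> x = \<zero>\<^bsub>prod_ring s F\<^esub>" if "x \<in> carrier (prod_ring s F)"
    using that null
    by (auto simp: prod_ring_def PiE_iff intro!: restrict_ext)
qed

lemma clonoid_kary: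
  assumes "linearly_closed_clonoid m K s F C" "(k, f) \<in> C"
  shows "k \<ge> 1" "f \<in> kary_funs m K s F k"
  using assms unfolding linearly_closed_clonoid_def by blast+

lemma clonoid_value:
  assumes "linearly_closed_clonoid m K s F C" "(k, f) \<in> C" "x \<in> vec_prod m K k"
  shows "f x \<in> carrier (prod_ring s F)"
  using clonoid_kary[OF assms(1,2)] assms(3) by (auto simp: kary_funs_def)

lemma clonoid_minor:
  assumes "linearly_closed_clonoid m K s F C" "(n, f) \<in> C" "l \<ge> 1"
    and "\<And>j r c. j < m \<Longrightarrow> r < n \<Longrightarrow> c < l \<Longrightarrow> A j r c \<in> carrier (K j)"
  shows "(l, \<lambda>x\<in>vec_prod m K l. f (\<lambda>j\<in>{..<m}. mat_vec (K j) n l (A j) (x j))) \<in> C"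
  using assms clonoid_kary(1)[OF assms(1,2)] unfolding linearly_closed_clonoid_def by blast

lemma clonoid_linear:
  assumes "linearly_closed_clonoid m K s F C" "(n, f) \<in> C" "(n, g) \<in> C"
    and "a \<in> carrier (prod_ring s F)" "b \<in> carrier (prod_ring s F)"
  shows "(n, \<lambda>x\<in>vec_prod m K n.
              a \<otimes>\<^bsub>prod_ring s F\<^esub> f x \<oplus>\<^bsub>prod_ring s F\<^esub> b \<otimes>\<^bsub>prod_ring s F\<^esub> g x) \<in> C"
  using assms clonoid_kary(1)[OF assms(1,2)] unfolding linearly_closed_clonoid_def by blast

lemma clonoid_add:
  assumes F: "\<And>i. i < s \<Longrightarrow> ring (F i)"
    and C: "linearly_closed_clonoid m K s F C" "(n, f) \<in> C" "(n, g) \<in> C"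
  shows "(n, \<lambda>x\<in>vec_prod m K n. f x \<oplus>\<^bsub>prod_ring s F\<^esub> g x) \<in> C"
proof -
  note one = prod_ring_scalars(1,2)[OF F]
  show ?thesis
    using clonoid_linear[OF C one(1) one(1)] clonoid_value[OF C(1,2)] clonoid_value[OF C(1,3)]
    by (simp add: one(2) cong: restrict_cong)
qed

lemma clonoid_zero:
  assumes F: "\<And>i. i < s \<Longrightarrow> ring (F i)"
    and C: "linearly_closed_clonoid m K s F C" "(n, f) \<in> C"
  shows "(n, \<lambda>x\<in>vec_prod m K n. \<zero>\<^bsub>prod_ring s F\<^esub>) \<in> C"
proof -
  interpret P: abelian_group "prod_ring s F" 
    by (rule abelian_group_prod_ring) (use F ring.is_abelian_group in blast)
  show ?thesis
    using clonoid_linear[OF C C(2) P.zero_closed P.zero_closed] clonoid_value[OF C(1,2)]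
    by (simp add: prod_ring_scalars(3)[OF F] cong: restrict_cong)
qed

text \<open>The empty sum is covered because \<open>C\<close> contains some \<open>n\<close>-ary function \<open>h\<close>, and with it the zero
  function of that arity.\<close>

lemma clonoid_foldr:
  assumes F: "\<And>i. i < s \<Longrightarrow> ring (F i)"
    and C: "linearly_closed_clonoid m K s F C" "(n, h) \<in> C"
    and \<phi>s: "\<And>\<phi>. \<phi> \<in> set \<phi>s \<Longrightarrow> (n, \<lambda>x\<in>vec_prod m K n. f (\<phi> x)) \<in> C"
  shows "(n, \<lambda>x\<in>vec_prod m K n.
    foldr (\<lambda>\<phi> a. f (\<phi> x) \<oplus>\<^bsub>prod_ring s F\<^esub> a) \<phi>s \<zero>\<^bsub>prod_ring s F\<^esub>) \<in> C"
  using \<phi>s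
proof (induction \<phi>s)
  case Nil
  show ?case unfolding foldr.simps id_apply by (rule clonoid_zero[OF F C])
next
  case (Cons \<phi> \<phi>s)
  let ?sum = "\<lambda>\<phi>s x. foldr (\<lambda>\<phi> a. f (\<phi> x) \<oplus>\<^bsub>prod_ring s F\<^esub> a) \<phi>s \<zero>\<^bsub>prod_ring s F\<^esub>"
  have "(n, \<lambda>x\<in>vec_prod m K n. f (\<phi> x)) \<in> C" "(n, \<lambda>x\<in>vec_prod m K n. ?sum \<phi>s x) \<in> C"
    by (rule Cons.prems, simp) (rule Cons.IH[OF Cons.prems], simp)
  note clonoid_add[OF F C(1) this]
  moreover have "(\<lambda>x\<in>vec_prod m K n. (\<lambda>x\<in>vec_prod m K n. f (\<phi> x)) x
      \<oplus>\<^bsub>prod_ring s F\<^esub> (\<lambda>x\<in>vec_prod m K n. ?sum \<phi>s x) x) = (\<lambda>x\<in>vec_prod m K n. ?sum (\<phi> # \<phi>s) x)"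
    by (rule restrict_ext) simp
  ultimately show ?case by (simp only:)
qed

lemma mat_vec_closed:
  assumes "ring R" "\<And>r c. r < n \<Longrightarrow> c < l \<Longrightarrow> A r c \<in> carrier R" "x \<in> {..<l} \<rightarrow>\<^sub>E carrier R"
  shows "mat_vec R n l A x \<in> {..<n} \<rightarrow>\<^sub>E carrier R"
proof -
  interpret ring R by fact
  show ?thesis
    unfolding mat_vec_def using assms(2,3) by (auto intro!: finsum_closed simp: PiE_iff)
qed

text \<open>Let \<open>f \<in> C\<close> be \<open>n\<close>-ary. For a tuple of rank-one matrices, \<open>f\<close> composed with the columns is a
  unary member of \<open>C\<close>, hence of \<open>D\<close>, and composing this with the rows stays in \<open>D\<close>. A sum of
  functions so obtained equals \<open>f\<close>.\<close>

lemma clonoid_determined_by_unary: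
  fixes K :: "nat \<Rightarrow> 'a ring" and F :: "nat \<Rightarrow> 'b ring"
  assumes K: "\<And>j. j < m \<Longrightarrow> field (K j) \<and> finite (carrier (K j))"
    and F: "\<And>i. i < s \<Longrightarrow> ring (F i) \<and> finite (carrier (F i))"
    and cop: "coprime (order (prod_ring m K)) (order (prod_ring s F))"
    and C: "linearly_closed_clonoid m K s F C"
    and D: "linearly_closed_clonoid m K s F D"
    and unary: "\<And>f. (1, f) \<in> C \<Longrightarrow> (1, f) \<in> D"
  shows "C \<subseteq> D"
proof (rule subrelI)
  fix n f assume f: "(n, f) \<in> C"
  let ?P = "prod_ring s F" and ?X = "vec_prod m K n"
  define N where "N = order ?P"
  have n: "n \<ge> 1" using clonoid_kary(1)[OF C f] .
  interpret P: abelian_group ?P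
    by (rule abelian_group_prod_ring) (use F ring.is_abelian_group in blast)
  have fin: "finite (carrier ?P)"
    using F by (auto simp: prod_ring_def intro!: finite_PiE)
  have "N > 0"
    unfolding N_def order_def using fin P.zero_closed card_gt_0_iff by blast
  have Kj: "field (K j) \<and> finite (carrier (K j)) \<and> coprime (card (carrier (K j))) N" if "j < m" for j
  proof -
    have "order (prod_ring m K) = (\<Prod>j<m. card (carrier (K j)))"
      by (simp add: order_def prod_ring_def card_PiE)
    then have "card (carrier (K j)) dvd order (prod_ring m K)"
      using that dvd_prodI[of "{..<m}" j "\<lambda>j. card (carrier (K j))"] by simp
    then have "coprime (card (carrier (K j))) N"
      unfolding N_def using cop by (rule coprime_divisors[OF _ dvd_refl])
    with K[OF that] show ?thesis by simp
  qed
  have Kring: "ring (K j)" if "j < m" for j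
    using K[OF that] by (simp add: field_def domain_def cring_def)
  let ?R = "{rank_one_on m K n m U V | U V.
      \<forall>i<m. U i \<in> UNIV \<rightarrow> carrier (K i) \<and> V i \<in> UNIV \<rightarrow> carrier (K i)}"
  have "(\<lambda>x f. f x) \<in> int_span N ?X ?R"
    using Kj \<open>N > 0\<close> by (rule rank_one_on_span) auto
  then obtain \<phi>s where \<phi>s: "set \<phi>s \<subseteq> ?R"
    and cong: "\<And>x g. x \<in> ?X \<Longrightarrow> [g x = (\<Sum>\<phi>\<leftarrow>\<phi>s. g (\<phi> x))] (mod int N)"
    by (rule int_spanE) (rule that)
  have \<phi>: "(n, \<lambda>x\<in>?X. f (\<phi> x)) \<in> D \<and> (\<forall>x\<in>?X. \<phi> x \<in> ?X)" if mem: "\<phi> \<in> set \<phi>s" for \<phi>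
  proof -
    obtain U V where \<phi>: "\<phi> = rank_one_on m K n m U V"
      and UV: "\<And>i. i < m \<Longrightarrow> U i \<in> UNIV \<rightarrow> carrier (K i) \<and> V i \<in> UNIV \<rightarrow> carrier (K i)"
      using \<phi>s mem by blast
    define up where "up y = (\<lambda>j\<in>{..<m}. mat_vec (K j) n 1 (\<lambda>r c. U j r) (y j))" for y
    define down where "down x = (\<lambda>j\<in>{..<m}. mat_vec (K j) 1 n (\<lambda>r c. V j c) (x j))" for x
    have down: "down x \<in> vec_prod m K 1" if "x \<in> ?X" for x
      using that UV Kring unfolding down_def vec_prod_def
      by (intro restrict_PiE_iff[THEN iffD2] ballI mat_vec_closed) (auto simp: PiE_iff Pi_iff)
    have up: "up y \<in> ?X" if "y \<in> vec_prod m K 1" for y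
      using that UV Kring unfolding up_def vec_prod_def
      by (intro restrict_PiE_iff[THEN iffD2] ballI mat_vec_closed) (auto simp: PiE_iff Pi_iff)
    have comp: "\<phi> x = up (down x)" for x
      unfolding \<phi> up_def down_def rank_one_on_def through_line_def
      by (intro restrict_ext) auto
    have "(1, \<lambda>y\<in>vec_prod m K 1. f (up y)) \<in> C"
      unfolding up_def using UV by (intro clonoid_minor[OF C f]) (auto simp: Pi_iff)
    then have f_up: "(1, \<lambda>y\<in>vec_prod m K 1. f (up y)) \<in> D" by (rule unary)
    have "(n, \<lambda>x\<in>?X. (\<lambda>y\<in>vec_prod m K 1. f (up y)) (down x)) \<in> D"
      unfolding down_def using UV by (intro clonoid_minor[OF D f_up n]) (auto simp: Pi_iff)
    moreover have "(\<lambda>x\<in>?X. (\<lambda>y\<in>vec_prod m K 1. f (up y)) (down x)) = (\<lambda>x\<in>?X. f (\<phi> x))"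
      by (intro restrict_ext) (simp add: down[unfolded One_nat_def] comp)
    ultimately show ?thesis using up down comp by simp
  qed
  \<comment> \<open>Any \<open>n\<close>-ary member of \<open>D\<close> will do; it only serves to have the zero function.\<close>
  obtain h where h: "(n, h) \<in> D"
  proof -
    have "(1, \<lambda>y\<in>vec_prod m K 1. f (\<lambda>j\<in>{..<m}. mat_vec (K j) n 1 (\<lambda>r c. \<zero>\<^bsub>K j\<^esub>) (y j))) \<in> C"
      using Kring by (intro clonoid_minor[OF C f]) (auto intro: ring.ring_simprules)
    note this[THEN unary]
    from clonoid_minor[OF D this n, of "\<lambda>j r c. \<zero>\<^bsub>K j\<^esub>"] Kring show ?thesis
      by (intro that) (auto intro: ring.ring_simprules)
  qed
  have "(n, \<lambda>x\<in>?X. foldr (\<lambda>\<phi> a. f (\<phi> x) \<oplus>\<^bsub>?P\<^esub> a) \<phi>s \<zero>\<^bsub>?P\<^esub>) \<in> D"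
    using F \<phi> by (intro clonoid_foldr[OF _ D h]) auto
  also have "(\<lambda>x\<in>?X. foldr (\<lambda>\<phi> a. f (\<phi> x) \<oplus>\<^bsub>?P\<^esub> a) \<phi>s \<zero>\<^bsub>?P\<^esub>) = (\<lambda>x\<in>?X. f x)"
  proof (rule restrict_ext)
    fix x assume x: "x \<in> ?X"
    have "foldr (\<lambda>p a. f p \<otimes>\<^bsub>add_monoid ?P\<^esub> a) (map (\<lambda>\<phi>. \<phi> x) \<phi>s) \<one>\<^bsub>add_monoid ?P\<^esub> = f x"
    proof (rule comm_group.foldr_eq_if_cong[OF P.a_comm_group])
      show "finite (carrier (add_monoid ?P))" using fin by simp
      show "f \<in> insert x (set (map (\<lambda>\<phi>. \<phi> x) \<phi>s)) \<rightarrow> carrier (add_monoid ?P)"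
        using \<phi> x clonoid_value[OF C f] by auto
      show "[g x = (\<Sum>p\<leftarrow>map (\<lambda>\<phi>. \<phi> x) \<phi>s. g p)] (mod int (order (add_monoid ?P)))"
        for g :: "_ \<Rightarrow> int"
        using cong[OF x, of g] by (simp add: N_def order_def comp_def)
    qed
    then show "foldr (\<lambda>\<phi> a. f (\<phi> x) \<oplus>\<^bsub>?P\<^esub> a) \<phi>s \<zero>\<^bsub>?P\<^esub> = f x"
      by (simp add: foldr_map comp_def)
  qed
  also have "(\<lambda>x\<in>?X. f x) = f"
    using clonoid_kary(2)[OF C f] by (simp add: kary_funs_def PiE_restrict)
  finally show "(n, f) \<in> D" .
qed

theorem theorem1p2:
  fixes m s :: nat and K :: "nat \<Rightarrow> 'a ring" and F :: "nat \<Rightarrow> 'b ring"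
  assumes "m \<ge> 1" and "s \<ge> 1"
    and "\<And>j. j < m \<Longrightarrow> field (K j) \<and> finite (carrier (K j))"
    and "\<And>i. i < s \<Longrightarrow> field (F i) \<and> finite (carrier (F i))"
    and "coprime (order (prod_ring m K)) (order (prod_ring s F))"
  shows "(\<forall>C. linearly_closed_clonoid m K s F C \<longrightarrow>
            (\<exists>S. S \<subseteq> {1} \<times> kary_funs m K s F 1 \<and> generated_by m K s F C S))
         \<and> finite {C. linearly_closed_clonoid m K s F C}"
proof
  let ?U = "{1 :: nat} \<times> kary_funs m K s F 1"
  have F: "ring (F i) \<and> finite (carrier (F i))" if "i < s" for i
    using assms(4)[OF that] by (simp add: field_def domain_def cring_def)
  have sub: "C \<subseteq> D"
    if "linearly_closed_clonoid m K s F C" "linearly_closed_clonoid m K s F D" "C \<inter> ?U \<subseteq> D" for C D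
    by (rule clonoid_determined_by_unary[OF _ _ assms(5) that(1,2)])
      (use assms(3) F clonoid_kary(2)[OF that(1)] that(3) in auto)
  show "\<forall>C. linearly_closed_clonoid m K s F C \<longrightarrow> (\<exists>S. S \<subseteq> ?U \<and> generated_by m K s F C S)"
  proof (intro allI impI exI conjI)
    fix C assume "linearly_closed_clonoid m K s F C"
    then show "generated_by m K s F C (C \<inter> ?U)"
      using sub by (auto simp: generated_by_def)
  qed auto
  show "finite {C. linearly_closed_clonoid m K s F C}"
  proof (rule inj_on_finite)
    show "inj_on (\<lambda>C. C \<inter> ?U) {C. linearly_closed_clonoid m K s F C}"
      by (rule inj_onI) (use sub in blast)
    show "(\<lambda>C. C \<inter> ?U) ` {C. linearly_closed_clonoid m K s F C} \<subseteq> Pow ?U" by auto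
    have "finite (vec_prod m K 1)" unfolding vec_prod_def using assms(3) by (intro finite_PiE) auto
    moreover have "finite (carrier (prod_ring s F))"
      using assms(4) by (auto simp: prod_ring_def intro!: finite_PiE)
    ultimately show "finite (Pow ?U)"
      unfolding kary_funs_def by (intro finite_Pow_iff[THEN iffD2] finite_cartesian_product finite_PiE) auto
  qed
qed

end
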